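(* Let $n,k\ge 1$, let $\Omega\subset\mathbb{R}^n$ be a bounded domain with Lipschitz boundary, and let $0<\delta<\delta_0$. Let $\lambda_1^\delta>0$ be the first eigenvalue of the $\delta$-discrete Dirichlet problem for the Laplacian in $\Omega^\delta$, and let $b_\delta>0$ be the unique positive solution of $$\cosh(\delta b_\delta)=1+\frac{1}{2k}\delta^2\lambda_1^\delta .$$ Let $u,v:\overline{\Omega}^\delta\times(\delta\mathbb{Z})^k\to\mathbb{R}$ be $\delta$-discrete harmonic functions in $\Omega^\delta\times(\delta\mathbb{Z})^k$ such that $$|u(x,y)|=o(\exp(b_\delta\|y\|_1)),\qquad |v(x,y)|=o(\exp(b_\delta\|y\|_1)),\qquad \|y\|_1\to\infty .$$ If $u=v$ on $\partial\Omega^\delta\times(\delta\mathbb{Z})^k$, then $u=v$ on $\Omega^\delta\times(\delta\mathbb{Z})^k$.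
   Context: For $y\in\mathbb{R}^k$, $\|y\|_1=|y_1|+\dots+|y_k|$. Two points of $(\delta\mathbb{Z})^m$ are neighbors if they differ by $\pm\delta e_j$ for some standard basis vector $e_j$. The $\delta$-discrete Laplacian on $(\delta\mathbb{Z})^m$ is $$\Delta_{\delta,m}u(x)=\delta^{-2}\Big(\sum_{j=1}^m\big(u(x+\delta e_j)+u(x-\delta e_j)\big)-2m\,u(x)\Big).$$ $\Omega^\delta=\Omega\cap(\delta\mathbb{Z})^n$; $\partial\Omega^\delta$ is the set of points of $(\delta\mathbb{Z})^n\setminus\Omega^\delta$ having at least one neighbor in $\Omega^\delta$; $\overline{\Omega}^\delta=\Omega^\delta\cup\partial\Omega^\delta$. The number $\delta_0>0$ is fixed, depending on $\Omega$, so small that for $0<\delta<\delta_0$ the set $\Omega^\delta$ is a nonempty discrete domain, i.e. connected in the lattice (any two points are joined by a path of neighboring points in $\Omega^\delta$). A function defined on $\overline{\Omega}^\delta\times(\delta\mathbb{Z})^k$ is $\delta$-discrete harmonic in $\Omega^\delta\times(\delta\mathbb{Z})^k$ if $\Delta_{\delta,n+k}u=0$ at every point of $\Omega^\delta\times(\delta\mathbb{Z})^k$. The discrete Dirichlet eigenvalue problem on $\Omega^\delta$ is: $-\Delta_{\delta,n}f=\lambda f$ in $\Omega^\delta$, $f=0$ on $\partial\Omega^\delta$. Its eigenvalues are positive, and $\lambda_1^\delta$ denotes the smallest one. The $o(\cdot)$ conditions mean: for every $\varepsilon>0$ there is $R>0$ such that the absolute value of the function at $(x,y)$ is at most $\varepsilon\exp(b_\delta\|y\|_1)$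 for all $x\in\overline{\Omega}^\delta$ and all $y\in(\delta\mathbb{Z})^k$ with $\|y\|_1\ge R$. *)

theory Defs
  imports "HOL-Analysis.Analysis"
begin

text \<open>
  The lattice and its Laplacian are defined on an arbitrary Euclidean space, so that they
  apply both to \<open>real ^ 'n\<close> and to the product \<open>(real ^ 'n) \<times> (real ^ 'k)\<close>. The basis of the
  latter consists of the vectors \<open>(e, 0)\<close> and \<open>(0, e)\<close>, and its dimension is \<open>n + k\<close>.
\<close>

definition lattice :: "real \<Rightarrow> 'a::euclidean_space set" where
  "lattice \<delta> = {x. \<forall>e\<in>Basis. \<exists>m::int. x \<bullet> e = \<delta> * of_int m}"

definition neighbors :: "real \<Rightarrow> 'a::euclidean_space \<Rightarrow> 'a \<Rightarrow> bool" where
  "neighbors \<delta> x y \<longleftrightarrow> (\<exists>e\<in>Basis. y = x + \<delta> *\<^sub>R e \<or> y = x - \<delta> *\<^sub>R e)"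

definition disc_laplacian :: "real \<Rightarrow> ('a::euclidean_space \<Rightarrow> real) \<Rightarrow> 'a \<Rightarrow> real" where
  "disc_laplacian \<delta> u x =
     ((\<Sum>e\<in>Basis. u (x + \<delta> *\<^sub>R e) + u (x - \<delta> *\<^sub>R e)) - 2 * real DIM('a) * u x) / \<delta>\<^sup>2"

definition disc_interior :: "real \<Rightarrow> 'a::euclidean_space set \<Rightarrow> 'a set" where
  "disc_interior \<delta> \<Omega> = \<Omega> \<inter> lattice \<delta>"

definition disc_boundary :: "real \<Rightarrow> 'a::euclidean_space set \<Rightarrow> 'a set" where
  "disc_boundary \<delta> \<Omega> =
     {x \<in> lattice \<delta> - disc_interior \<delta> \<Omega>. \<exists>y\<in>disc_interior \<delta> \<Omega>. neighbors \<delta> x y}"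

definition disc_closure :: "real \<Rightarrow> 'a::euclidean_space set \<Rightarrow> 'a set" where
  "disc_closure \<delta> \<Omega> = disc_interior \<delta> \<Omega> \<union> disc_boundary \<delta> \<Omega>"

definition disc_connected :: "real \<Rightarrow> 'a::euclidean_space set \<Rightarrow> bool" where
  "disc_connected \<delta> S \<longleftrightarrow>
     (\<forall>x\<in>S. \<forall>y\<in>S. (x, y) \<in> {(p, q). p \<in> S \<and> q \<in> S \<and> neighbors \<delta> p q}\<^sup>*)"

text \<open>The defining property of the threshold \<open>\<delta>\<^sub>0\<close> for the mesh size.\<close>

definition mesh_bound :: "'a::euclidean_space set \<Rightarrow> real \<Rightarrow> bool" where
  "mesh_bound \<Omega> \<delta>0 \<longleftrightarrow> 0 < \<delta>0 \<and>
     (\<forall>\<delta>. 0 < \<delta> \<and> \<delta> < \<delta>0 \<longrightarrow>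
        disc_interior \<delta> \<Omega> \<noteq> {} \<and> disc_connected \<delta> (disc_interior \<delta> \<Omega>))"

text \<open>
  Near each boundary point, \<open>\<Omega>\<close> lies strictly above the graph of a Lipschitz function \<open>g\<close> on
  the hyperplane orthogonal to some unit vector \<open>e\<close>. In dimension 1 this hyperplane is \<open>{0}\<close>.
\<close>

definition lipschitz_boundary :: "'a::euclidean_space set \<Rightarrow> bool" where
  "lipschitz_boundary \<Omega> \<longleftrightarrow>
     (\<forall>p\<in>frontier \<Omega>. \<exists>e r C g. norm e = 1 \<and> 0 < r \<and> C-lipschitz_on {z. z \<bullet> e = 0} g \<and>
        \<Omega> \<inter> ball p r = {x \<in> ball p r. g (x - (x \<bullet> e) *\<^sub>R e) < x \<bullet> e})"

definition bounded_lipschitz_domain :: "'a::euclidean_space set \<Rightarrow> bool" where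
  "bounded_lipschitz_domain \<Omega> \<longleftrightarrow>
     open \<Omega> \<and> connected \<Omega> \<and> \<Omega> \<noteq> {} \<and> bounded \<Omega> \<and> lipschitz_boundary \<Omega>"

text \<open>
  Functions on \<open>disc_closure \<delta> \<Omega>\<close>, or on its product with a lattice, are represented by total
  functions; the conditions below do not depend on the values elsewhere.
\<close>

definition dirichlet_eigenvalue :: "real \<Rightarrow> 'a::euclidean_space set \<Rightarrow> real \<Rightarrow> bool" where
  "dirichlet_eigenvalue \<delta> \<Omega> \<mu> \<longleftrightarrow>
     (\<exists>f. (\<exists>x\<in>disc_interior \<delta> \<Omega>. f x \<noteq> 0) \<and>
          (\<forall>x\<in>disc_interior \<delta> \<Omega>. - disc_laplacian \<delta> f x = \<mu> * f x) \<and>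
          (\<forall>x\<in>disc_boundary \<delta> \<Omega>. f x = 0))"

definition first_eigenvalue :: "real \<Rightarrow> 'a::euclidean_space set \<Rightarrow> real" where
  "first_eigenvalue \<delta> \<Omega> = (LEAST \<mu>. dirichlet_eigenvalue \<delta> \<Omega> \<mu>)"

definition disc_harmonic_on ::
    "real \<Rightarrow> 'a::euclidean_space set \<Rightarrow> ('a \<Rightarrow> real) \<Rightarrow> bool" where
  "disc_harmonic_on \<delta> S u \<longleftrightarrow> (\<forall>z\<in>S. disc_laplacian \<delta> u z = 0)"

definition norm1 :: "real ^ 'k \<Rightarrow> real" where
  "norm1 y = (\<Sum>j\<in>UNIV. \<bar>y $ j\<bar>)"

definition little_o_exp ::
    "real \<Rightarrow> (real ^ 'n) set \<Rightarrow> real \<Rightarrow> ((real ^ 'n) \<times> (real ^ 'k) \<Rightarrow> real) \<Rightarrow> bool" where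
  "little_o_exp \<delta> \<Omega> b u \<longleftrightarrow>
     (\<forall>\<epsilon>>0. \<exists>R>0. \<forall>x\<in>disc_closure \<delta> \<Omega>. \<forall>y\<in>lattice \<delta>.
        norm1 y \<ge> R \<longrightarrow> \<bar>u (x, y)\<bar> \<le> \<epsilon> * exp (b * norm1 y))"

end

theory Submission imports Defs begin

text \<open>
  The difference \<open>w = u - v\<close> is discrete harmonic, vanishes on the lateral boundary and is
  \<open>o(exp (b \<parallel>y\<parallel>\<^sub>1))\<close>. It is compared with the barrier
  \<open>h(x, y) = f(x) \<Prod>\<^sub>j cosh (b y\<^sub>j)\<close>, where \<open>f\<close> is a first Dirichlet eigenfunction that is strictly
  positive on \<open>\<Omega>\<^sup>\<delta>\<close> (\<open>first_eigenfunction\<close>).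

  The product of the \<open>cosh\<close> factors is an eigenfunction of the Laplacian in \<open>y\<close> with eigenvalue
  \<open>2k (cosh (\<delta> b) - 1) / \<delta>\<^sup>2\<close> (\<open>disc_laplacian_prod_cosh\<close>), which by the choice of \<open>b\<close> equals the
  first eigenvalue; hence \<open>h\<close> is discrete harmonic. It vanishes on the lateral boundary, and it is
  at least a positive constant times \<open>exp (b \<parallel>y\<parallel>\<^sub>1)\<close> because \<open>f\<close> is bounded below on the finite set
  \<open>\<Omega>\<^sup>\<delta>\<close> and \<open>2 cosh t \<ge> exp \<bar>t\<bar>\<close>. So for every \<open>\<epsilon> > 0\<close> the inequality \<open>\<bar>w\<bar> \<le> \<epsilon> h\<close> holds for large
  \<open>y\<close>; the maximum principle on the remaining finite set (\<open>cylinder_comparison_principle\<close>)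
  extends it to the whole cylinder, and \<open>\<epsilon> \<rightarrow> 0\<close> gives \<open>w = 0\<close>.

  The positive eigenfunction comes from the symmetric case of the Perron--Frobenius theorem
  (\<open>perron_frobenius_symmetric\<close>) for the adjacency matrix of \<open>\<Omega>\<^sup>\<delta>\<close>, which is irreducible since
  \<open>\<Omega>\<^sup>\<delta>\<close> is connected: with Dirichlet data, \<open>-\<Delta>\<close> is \<open>(2n - A) / \<delta>\<^sup>2\<close>, so the largest eigenvalue
  of the adjacency matrix \<open>A\<close> corresponds to the smallest Dirichlet eigenvalue.
\<close>

section \<open>Perron--Frobenius for symmetric matrices\<close>

lemma sum_symmetric_swap:
  fixes A :: "'a \<Rightarrow> 'a \<Rightarrow> real"
  assumes "\<And>x y. A x y = A y x"
  shows "(\<Sum>x\<in>S. \<Sum>y\<in>S. A x y * f x * g y) = (\<Sum>x\<in>S. \<Sum>y\<in>S. A x y * g x * f y)"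
  by (subst sum.swap, intro sum.cong refl) (simp add: assms mult_ac)

text \<open>
  Vectors indexed by \<open>S\<close> are functions on the whole type, so only their values on \<open>S\<close> are
  constrained. Compactness of the unit sphere is obtained from Tychonoff's theorem applied to
  functions with values in \<open>[-1, 1]\<close> on \<open>S\<close> and \<open>0\<close> elsewhere.
\<close>

lemma quadratic_form_attains_max:
  fixes A :: "'a \<Rightarrow> 'a \<Rightarrow> real"
  assumes fin: "finite S" and ne: "S \<noteq> {}"
  obtains f where "(\<Sum>x\<in>S. (f x)\<^sup>2) = 1"
    and "\<And>g. (\<Sum>x\<in>S. (g x)\<^sup>2) = 1 \<Longrightarrow>
           (\<Sum>x\<in>S. \<Sum>y\<in>S. A x y * g x * g y) \<le> (\<Sum>x\<in>S. \<Sum>y\<in>S. A x y * f x * f y)"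
proof -
  define P :: "('a \<Rightarrow> real) set" where "P = PiE UNIV (\<lambda>x. if x \<in> S then {-1..1} else {0})"
  define K where "K = P \<inter> (\<lambda>f. \<Sum>x\<in>S. (f x)\<^sup>2) -` {1}"
  define G where "G = (\<lambda>f::'a \<Rightarrow> real. \<Sum>x\<in>S. \<Sum>y\<in>S. A x y * f x * f y)"
  have "compactin (product_topology (\<lambda>_. euclidean) UNIV) P"
    unfolding P_def by (subst compactin_PiE) auto
  hence "compact P"
    by (simp add: euclidean_product_topology)
  have coord: "continuous_on T (\<lambda>f::'a \<Rightarrow> real. f x)" for T x
    by (rule continuous_on_subset[OF continuous_on_product_coordinates]) auto
  have "closed ((\<lambda>f::'a \<Rightarrow> real. \<Sum>x\<in>S. (f x)\<^sup>2) -` {1})"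
    by (rule closed_vimage) (auto intro!: continuous_intros coord)
  with \<open>compact P\<close> have K: "compact K"
    unfolding K_def by (rule compact_Int_closed)
  have cG: "continuous_on K G"
    unfolding G_def by (intro continuous_intros coord)
  have restr: "(\<lambda>x. if x \<in> S then g x else 0) \<in> K" if "(\<Sum>x\<in>S. (g x)\<^sup>2) = 1" for g
  proof -
    have "\<bar>g x\<bar> \<le> 1" if "x \<in> S" for x
    proof -
      have "(g x)\<^sup>2 \<le> (\<Sum>x\<in>S. (g x)\<^sup>2)"
        by (rule member_le_sum) (use that fin in auto)
      thus ?thesis using \<open>(\<Sum>x\<in>S. (g x)\<^sup>2) = 1\<close> by (simp add: abs_square_le_1)
    qed
    moreover have "(\<Sum>x\<in>S. (if x \<in> S then g x else 0)\<^sup>2) = 1"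
      using that by (simp cong: sum.cong)
    ultimately show ?thesis
      unfolding K_def P_def by (auto simp: PiE_def Pi_def abs_le_iff minus_le_iff)
  qed
  obtain z where "z \<in> S" using ne by blast
  have "(\<Sum>x\<in>S. (if x = z then 1 else 0::real)\<^sup>2) = (\<Sum>x\<in>S. if x = z then 1 else 0)"
    by (rule sum.cong) auto
  hence "(\<Sum>x\<in>S. (if x = z then 1 else 0::real)\<^sup>2) = 1"
    using \<open>z \<in> S\<close> fin by simp
  from restr[OF this] have "K \<noteq> {}" by blast
  from continuous_attains_sup[OF K this cG]
  obtain f where f: "f \<in> K" "\<And>g. g \<in> K \<Longrightarrow> G g \<le> G f" by blast
  show ?thesis
  proof (rule that)
    show "(\<Sum>x\<in>S. (f x)\<^sup>2) = 1" using f(1) by (auto simp: K_def)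
  next
    fix g assume "(\<Sum>x\<in>S. (g x)\<^sup>2) = (1::real)"
    from f(2)[OF restr[OF this]]
    show "(\<Sum>x\<in>S. \<Sum>y\<in>S. A x y * g x * g y) \<le> (\<Sum>x\<in>S. \<Sum>y\<in>S. A x y * f x * f y)"
      by (simp add: G_def cong: sum.cong)
  qed
qed

lemma linear_le_quadratic_imp_zero:
  fixes c K :: real
  assumes "\<And>t. t * c \<le> K * t\<^sup>2"
  shows "c = 0"
proof (rule ccontr)
  assume "c \<noteq> 0"
  define L where "L = \<bar>K\<bar> + 1"
  have "L > 0" by (simp add: L_def)
  have "(c / (2 * L)) * c \<le> K * (c / (2 * L))\<^sup>2" by (rule assms)
  also have "\<dots> \<le> L * (c / (2 * L))\<^sup>2"
    by (rule mult_right_mono) (auto simp: L_def)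
  also have "\<dots> = c\<^sup>2 / (4 * L)"
    using \<open>L > 0\<close> by (simp add: power2_eq_square field_simps)
  finally have "c\<^sup>2 / (2 * L) \<le> c\<^sup>2 / (4 * L)" by (simp add: power2_eq_square)
  with \<open>L > 0\<close> have "c\<^sup>2 \<le> 0" by (simp add: field_simps)
  with \<open>c \<noteq> 0\<close> show False by simp
qed

text \<open>
  The absolute value of a maximiser of the quadratic form on the unit sphere is again a
  maximiser, since \<open>A\<close> has nonnegative entries, and hence an eigenvector for the maximum \<open>M\<close>. If
  it vanished at one index, the eigenvector equation would make it vanish at all adjacent
  indices, and by irreducibility everywhere.
\<close>

lemma perron_frobenius_symmetric:
  fixes A :: "'a \<Rightarrow> 'a \<Rightarrow> real"
  assumes fin: "finite S" and ne: "S \<noteq> {}"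
    and sym: "\<And>x y. A x y = A y x"
    and nonneg: "\<And>x y. 0 \<le> A x y"
    and irred: "\<And>x y. x \<in> S \<Longrightarrow> y \<in> S \<Longrightarrow>
                  (x, y) \<in> {(p, q). p \<in> S \<and> q \<in> S \<and> 0 < A p q}\<^sup>*"
  obtains M f where "\<forall>x\<in>S. 0 < f x"
    and "\<forall>x\<in>S. (\<Sum>y\<in>S. A x y * f y) = M * f x"
    and "\<forall>g m. (\<exists>x\<in>S. g x \<noteq> 0) \<longrightarrow> (\<forall>x\<in>S. (\<Sum>y\<in>S. A x y * g y) = m * g x) \<longrightarrow> m \<le> M"
proof -
  define G where "G = (\<lambda>f g::'a \<Rightarrow> real. \<Sum>x\<in>S. \<Sum>y\<in>S. A x y * f x * g y)"
  define N where "N = (\<lambda>f::'a \<Rightarrow> real. \<Sum>x\<in>S. (f x)\<^sup>2)"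
  obtain f0 where f0: "N f0 = 1" and max0: "\<And>g. N g = 1 \<Longrightarrow> G g g \<le> G f0 f0"
    unfolding N_def G_def using quadratic_form_attains_max[OF fin ne, of A] by blast
  define M where "M = G f0 f0"
  have Npos: "N g > 0" if "x \<in> S" "g x \<noteq> 0" for g x
    unfolding N_def by (rule sum_pos2[OF fin that(1)]) (use that in auto)
  have bound: "G g g \<le> M * N g" for g
  proof (cases "\<exists>x\<in>S. g x \<noteq> 0")
    case True
    hence pos: "N g > 0" using Npos by blast
    define s where "s = N g"
    have s: "s > 0" using pos by (simp add: s_def)
    define h where "h = (\<lambda>x. g x / sqrt s)"
    have "N h = N g / s"
      unfolding N_def h_def sum_divide_distrib using s by (simp add: power_divide)
    hence "N h = 1" using s by (simp add: s_def)
    hence "G h h \<le> M" using max0 unfolding M_def by blast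
    moreover have "G h h = G g g / s"
      unfolding G_def h_def sum_divide_distrib using s by (intro sum.cong refl) simp
    ultimately show ?thesis using s by (simp add: field_simps s_def)
  next
    case False
    hence "G g g = 0" "N g = 0" unfolding G_def N_def by (auto intro!: sum.neutral)
    thus ?thesis by simp
  qed
  define f where "f = (\<lambda>x. \<bar>f0 x\<bar>)"
  have Nf: "N f = 1" using f0 by (simp add: N_def f_def)
  have "G f0 f0 \<le> G f f"
    unfolding G_def f_def
  proof (intro sum_mono)
    fix x y
    have "f0 x * f0 y \<le> \<bar>f0 x\<bar> * \<bar>f0 y\<bar>" by (metis abs_ge_self abs_mult)
    from mult_left_mono[OF this nonneg[of x y]]
    show "A x y * f0 x * f0 y \<le> A x y * \<bar>f0 x\<bar> * \<bar>f0 y\<bar>" by (simp add: mult.assoc)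
  qed
  with bound[of f] Nf have Gf: "G f f = M" by (simp add: M_def)
  have eig: "(\<Sum>y\<in>S. A z y * f y) = M * f z" if z: "z \<in> S" for z
  proof -
    define e :: "'a \<Rightarrow> real" where "e = (\<lambda>x. if x = z then 1 else 0)"
    have Gef: "G e f = (\<Sum>y\<in>S. A z y * f y)"
    proof -
      have "G e f = (\<Sum>x\<in>S. if x = z then \<Sum>y\<in>S. A z y * f y else 0)"
        unfolding G_def e_def by (rule sum.cong) auto
      thus ?thesis using z fin by simp
    qed
    have Ne: "(\<Sum>x\<in>S. f x * e x) = f z" "N e = 1"
      using z fin by (simp_all add: e_def N_def if_distrib power2_eq_square cong: if_cong)
    have Gfe: "G f e = G e f"
      unfolding G_def by (rule sum_symmetric_swap[OF sym])
    \<comment> \<open>the first variation of \<open>G - M N\<close> at its maximum point \<open>f\<close>, in the direction \<open>e\<close>\<close>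
    have "2 * ((\<Sum>y\<in>S. A z y * f y) - M * f z) = 0"
    proof (rule linear_le_quadratic_imp_zero)
      fix t :: real
      define h where "h = (\<lambda>x. f x + t * e x)"
      have "G h h = G f f + t * G e f + t * G f e + t\<^sup>2 * G e e"
        unfolding G_def h_def
        by (simp add: algebra_simps sum.distrib sum_distrib_left power2_eq_square)
      moreover have "N h = N f + 2 * t * (\<Sum>x\<in>S. f x * e x) + t\<^sup>2 * N e"
        unfolding N_def h_def
        by (simp add: algebra_simps sum.distrib sum_distrib_left power2_eq_square)
      ultimately show "t * (2 * ((\<Sum>y\<in>S. A z y * f y) - M * f z)) \<le> (M - G e e) * t\<^sup>2"
        using bound[of h] Gfe Gf Nf Ne Gef by (simp add: algebra_simps)
    qed
    thus ?thesis by simp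
  qed
  have f_nonneg: "f x \<ge> 0" for x by (simp add: f_def)
  have zero_step: "f y = 0" if "x \<in> S" "y \<in> S" "A x y > 0" "f x = 0" for x y
  proof -
    have "(\<Sum>y\<in>S. A x y * f y) = 0" using eig[of x] that by simp
    hence "A x y * f y = 0"
      using sum_nonneg_eq_0_iff[OF fin, of "\<lambda>y. A x y * f y"] nonneg f_nonneg that(2) by auto
    thus ?thesis using that by simp
  qed
  have pos: "f x > 0" if x: "x \<in> S" for x
  proof (rule ccontr)
    assume "\<not> f x > 0"
    hence "f x = 0" using f_nonneg[of x] by simp
    have "f y = 0" if "y \<in> S" for y
      using irred[OF x that]
      by (induction rule: rtrancl_induct) (use \<open>f x = 0\<close> zero_step in auto)
    hence "N f = 0" by (simp add: N_def)
    with Nf show False by simp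
  qed
  have top: "m \<le> M"
    if x: "x \<in> S" "g x \<noteq> 0"
      and g: "\<And>x. x \<in> S \<Longrightarrow> (\<Sum>y\<in>S. A x y * g y) = m * g x" for g m x
  proof -
    have "G g g = (\<Sum>x\<in>S. g x * (\<Sum>y\<in>S. A x y * g y))"
      by (simp add: G_def sum_distrib_left mult_ac)
    also have "\<dots> = m * N g"
      unfolding N_def sum_distrib_left[of m] using g
      by (intro sum.cong refl) (simp add: power2_eq_square)
    finally have "m * N g \<le> M * N g" using bound[of g] by simp
    thus ?thesis using Npos[of x g] x by simp
  qed
  show ?thesis
  proof (rule that[of f M])
    show "\<forall>g m. (\<exists>x\<in>S. g x \<noteq> 0) \<longrightarrow> (\<forall>x\<in>S. (\<Sum>y\<in>S. A x y * g y) = m * g x) \<longrightarrow> m \<le> M"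
      using top by blast
  qed (use pos eig in auto)
qed

section \<open>Lattice points\<close>

lemma finite_disc_interior:
  fixes \<Omega> :: "'a::euclidean_space set"
  assumes "bounded \<Omega>" "0 < \<delta>"
  shows "finite (disc_interior \<delta> \<Omega>)"
proof -
  obtain B where B: "\<And>x. x \<in> \<Omega> \<Longrightarrow> norm x \<le> B" using assms(1) by (auto simp: bounded_iff)
  define N where "N = \<lceil>B / \<delta>\<rceil>"
  define F where "F = (\<lambda>m::int. \<delta> * of_int m) ` {-N..N}"
  have "(\<lambda>x. \<lambda>e\<in>Basis. x \<bullet> e) ` disc_interior \<delta> \<Omega> \<subseteq> (Basis :: 'a set) \<rightarrow>\<^sub>E F"
  proof (intro image_subsetI, unfold restrict_PiE_iff, intro ballI)
    fix x e :: 'a assume x: "x \<in> disc_interior \<delta> \<Omega>" and e: "e \<in> Basis"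
    then obtain m :: int where m: "x \<bullet> e = \<delta> * of_int m"
      by (auto simp: disc_interior_def lattice_def)
    have "\<bar>x \<bullet> e\<bar> \<le> B"
      using Basis_le_norm[OF e, of x] B x by (force simp: disc_interior_def)
    hence "\<bar>of_int m\<bar> \<le> B / \<delta>"
      using assms(2) by (simp add: m abs_mult field_simps)
    hence "\<bar>m\<bar> \<le> N" unfolding N_def by linarith
    thus "x \<bullet> e \<in> F" using m unfolding F_def by (intro image_eqI[of _ _ m]) auto
  qed
  moreover have "finite ((Basis :: 'a set) \<rightarrow>\<^sub>E F)"
    by (rule finite_PiE) (auto simp: F_def)
  ultimately have "finite ((\<lambda>x. \<lambda>e\<in>Basis. x \<bullet> e) ` disc_interior \<delta> \<Omega>)"
    by (rule finite_subset)
  thus ?thesis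
  proof (rule finite_imageD)
    show "inj_on (\<lambda>x. \<lambda>e\<in>Basis. x \<bullet> e) (disc_interior \<delta> \<Omega>)"
    proof (rule inj_onI, rule euclidean_eqI)
      fix x y e :: 'a
      assume eq: "(\<lambda>e\<in>Basis. x \<bullet> e) = (\<lambda>e\<in>Basis. y \<bullet> e)" and e: "e \<in> Basis"
      show "x \<bullet> e = y \<bullet> e" using fun_cong[OF eq, of e] e by simp
    qed
  qed
qed

lemma lattice_step:
  fixes x :: "'a::euclidean_space"
  assumes "x \<in> lattice \<delta>" "e \<in> Basis"
  shows "x + \<delta> *\<^sub>R e \<in> lattice \<delta>" "x - \<delta> *\<^sub>R e \<in> lattice \<delta>"
proof -
  have "\<exists>m'::int. (x + \<delta> *\<^sub>R e) \<bullet> e' = \<delta> * of_int m'"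
       "\<exists>m'::int. (x - \<delta> *\<^sub>R e) \<bullet> e' = \<delta> * of_int m'" if e': "e' \<in> Basis" for e'
  proof -
    obtain m :: int where m: "x \<bullet> e' = \<delta> * of_int m"
      using assms(1) e' unfolding lattice_def by blast
    show "\<exists>m'::int. (x + \<delta> *\<^sub>R e) \<bullet> e' = \<delta> * of_int m'"
      by (rule exI[of _ "m + (if e = e' then 1 else 0)"])
         (use m assms(2) e' in \<open>auto simp: inner_add_left inner_Basis algebra_simps\<close>)
    show "\<exists>m'::int. (x - \<delta> *\<^sub>R e) \<bullet> e' = \<delta> * of_int m'"
      by (rule exI[of _ "m - (if e = e' then 1 else 0)"])
         (use m assms(2) e' in \<open>auto simp: inner_diff_left inner_Basis algebra_simps\<close>)
  qed
  thus "x + \<delta> *\<^sub>R e \<in> lattice \<delta>" "x - \<delta> *\<^sub>R e \<in> lattice \<delta>"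
    by (auto simp: lattice_def)
qed

lemma disc_closure_step:
  fixes x :: "'a::euclidean_space"
  assumes "x \<in> disc_interior \<delta> \<Omega>" "e \<in> Basis"
  shows "x + \<delta> *\<^sub>R e \<in> disc_closure \<delta> \<Omega>" "x - \<delta> *\<^sub>R e \<in> disc_closure \<delta> \<Omega>"
proof -
  have x: "x \<in> lattice \<delta>" using assms(1) by (simp add: disc_interior_def)
  have "neighbors \<delta> (x + \<delta> *\<^sub>R e) x" "neighbors \<delta> (x - \<delta> *\<^sub>R e) x"
    using assms(2) by (auto simp: neighbors_def intro!: bexI[of _ e])
  thus "x + \<delta> *\<^sub>R e \<in> disc_closure \<delta> \<Omega>" "x - \<delta> *\<^sub>R e \<in> disc_closure \<delta> \<Omega>"
    using lattice_step[OF x assms(2)] assms(1)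
    by (auto simp: disc_closure_def disc_boundary_def)
qed

section \<open>The first Dirichlet eigenfunction\<close>

text \<open>
  The adjacency matrix of the lattice. For \<open>\<delta> \<noteq> 0\<close> its entries are 0 and 1; written as a sum over
  the steps \<open>\<plusminus>\<delta> e\<close>, it turns the Laplacian into a matrix product by exchanging two sums.
\<close>

definition adjacency :: "real \<Rightarrow> 'a::euclidean_space \<Rightarrow> 'a \<Rightarrow> real" where
  "adjacency \<delta> x y =
     (\<Sum>e\<in>Basis. (if y = x + \<delta> *\<^sub>R e then 1 else 0) + (if y = x - \<delta> *\<^sub>R e then 1 else 0))"

lemma adjacency_sym: "adjacency \<delta> x y = adjacency \<delta> y x"
  unfolding adjacency_def
  by (intro sum.cong refl) (auto simp: algebra_simps)

lemma adjacency_nonneg: "0 \<le> adjacency \<delta> x y"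
  unfolding adjacency_def by (intro sum_nonneg) auto

lemma adjacency_pos: "neighbors \<delta> x y \<Longrightarrow> 0 < adjacency \<delta> x y"
  unfolding adjacency_def neighbors_def
  by (erule bexE, rule sum_pos2) auto

lemma disc_laplacian_adjacency:
  fixes f :: "'a::euclidean_space \<Rightarrow> real"
  assumes fin: "finite (disc_interior \<delta> \<Omega>)" and x: "x \<in> disc_interior \<delta> \<Omega>"
    and bd: "\<And>z. z \<in> disc_boundary \<delta> \<Omega> \<Longrightarrow> f z = 0"
  shows "disc_laplacian \<delta> f x =
     ((\<Sum>y\<in>disc_interior \<delta> \<Omega>. adjacency \<delta> x y * f y) - 2 * real DIM('a) * f x) / \<delta>\<^sup>2"
proof -
  let ?S = "disc_interior \<delta> \<Omega>"
  have pt: "(\<Sum>y\<in>?S. (if y = z then 1 else 0) * f y) = f z" if "z \<in> disc_closure \<delta> \<Omega>" for z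
  proof -
    have "(\<Sum>y\<in>?S. (if y = z then 1 else 0) * f y) = (\<Sum>y\<in>?S. if y = z then f z else 0)"
      by (rule sum.cong) auto
    also have "\<dots> = f z" using fin bd that by (auto simp: disc_closure_def)
    finally show ?thesis .
  qed
  have "(\<Sum>y\<in>?S. adjacency \<delta> x y * f y) =
      (\<Sum>e\<in>Basis. (\<Sum>y\<in>?S. (if y = x + \<delta> *\<^sub>R e then 1 else 0) * f y)
                   + (\<Sum>y\<in>?S. (if y = x - \<delta> *\<^sub>R e then 1 else 0) * f y))"
    unfolding adjacency_def sum_distrib_right
    by (subst sum.swap) (simp only: distrib_right sum.distrib)
  also have "\<dots> = (\<Sum>e\<in>Basis. f (x + \<delta> *\<^sub>R e) + f (x - \<delta> *\<^sub>R e))"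
    by (intro sum.cong refl arg_cong2[of _ _ _ _ "(+)"] pt disc_closure_step[OF x])
  finally show ?thesis by (simp add: disc_laplacian_def)
qed

lemma first_eigenfunction:
  fixes \<Omega> :: "'a::euclidean_space set"
  assumes fin: "finite (disc_interior \<delta> \<Omega>)" and ne: "disc_interior \<delta> \<Omega> \<noteq> {}"
    and conn: "disc_connected \<delta> (disc_interior \<delta> \<Omega>)" and \<delta>: "0 < \<delta>"
  obtains f where "\<And>x. x \<in> disc_interior \<delta> \<Omega> \<Longrightarrow> 0 < f x"
    and "\<And>x. x \<in> disc_boundary \<delta> \<Omega> \<Longrightarrow> f x = 0"
    and "\<And>x. x \<in> disc_interior \<delta> \<Omega> \<Longrightarrow>
           disc_laplacian \<delta> f x = - (first_eigenvalue \<delta> \<Omega> * f x)"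
proof -
  let ?S = "disc_interior \<delta> \<Omega>" and ?d = "2 * real DIM('a)"
  have irred: "(x, y) \<in> {(p, q). p \<in> ?S \<and> q \<in> ?S \<and> 0 < adjacency \<delta> p q}\<^sup>*"
    if "x \<in> ?S" "y \<in> ?S" for x y
  proof -
    have "(x, y) \<in> {(p, q). p \<in> ?S \<and> q \<in> ?S \<and> neighbors \<delta> p q}\<^sup>*"
      using conn that by (auto simp: disc_connected_def)
    moreover have "{(p, q). p \<in> ?S \<and> q \<in> ?S \<and> neighbors \<delta> p q}
        \<subseteq> {(p, q). p \<in> ?S \<and> q \<in> ?S \<and> 0 < adjacency \<delta> p q}"
      using adjacency_pos by blast
    ultimately show ?thesis using rtrancl_mono by blast
  qed
  obtain M f0 where pos: "\<forall>x\<in>?S. 0 < f0 x"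
    and eig: "\<forall>x\<in>?S. (\<Sum>y\<in>?S. adjacency \<delta> x y * f0 y) = M * f0 x"
    and top: "\<forall>g m. (\<exists>x\<in>?S. g x \<noteq> 0) \<longrightarrow>
           (\<forall>x\<in>?S. (\<Sum>y\<in>?S. adjacency \<delta> x y * g y) = m * g x) \<longrightarrow> m \<le> M"
    by (rule perron_frobenius_symmetric[OF fin ne adjacency_sym adjacency_nonneg irred])
  define f where "f = (\<lambda>x. if x \<in> ?S then f0 x else 0)"
  have bd: "f x = 0" if "x \<in> disc_boundary \<delta> \<Omega>" for x
    using that by (auto simp: f_def disc_boundary_def)
  have fpos: "0 < f x" if "x \<in> ?S" for x using pos that by (simp add: f_def)
  define \<mu> where "\<mu> = (?d - M) / \<delta>\<^sup>2"
  have lap: "disc_laplacian \<delta> f x = - (\<mu> * f x)" if x: "x \<in> ?S" for x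
  proof -
    have "(\<Sum>y\<in>?S. adjacency \<delta> x y * f y) = M * f x"
      using eig x by (simp add: f_def cong: sum.cong)
    thus ?thesis
      using \<delta> by (simp add: disc_laplacian_adjacency[OF fin x bd] \<mu>_def field_simps)
  qed
  have "first_eigenvalue \<delta> \<Omega> = \<mu>"
    unfolding first_eigenvalue_def
  proof (rule Least_equality)
    obtain x where "x \<in> ?S" using ne by blast
    with fpos have "\<exists>x\<in>?S. f x \<noteq> 0" by force
    thus "dirichlet_eigenvalue \<delta> \<Omega> \<mu>"
      unfolding dirichlet_eigenvalue_def using lap bd by (intro exI[of _ f]) auto
  next
    fix m assume "dirichlet_eigenvalue \<delta> \<Omega> m"
    then obtain g x where x: "x \<in> ?S" "g x \<noteq> 0"
      and g: "\<And>x. x \<in> ?S \<Longrightarrow> - disc_laplacian \<delta> g x = m * g x"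
      and gb: "\<And>x. x \<in> disc_boundary \<delta> \<Omega> \<Longrightarrow> g x = 0"
      unfolding dirichlet_eigenvalue_def by blast
    have "?d - m * \<delta>\<^sup>2 \<le> M"
    proof (rule top[rule_format])
      show "\<exists>x\<in>?S. g x \<noteq> 0" using x by blast
    next
      fix z assume z: "z \<in> ?S"
      show "(\<Sum>y\<in>?S. adjacency \<delta> z y * g y) = (?d - m * \<delta>\<^sup>2) * g z"
        using g[OF z] disc_laplacian_adjacency[OF fin z gb] \<delta> by (simp add: field_simps)
    qed
    thus "\<mu> \<le> m" using \<delta> by (simp add: \<mu>_def field_simps)
  qed
  thus ?thesis using that[of f] fpos bd lap by blast
qed

section \<open>A discrete harmonic barrier of exponential growth\<close>

lemma disc_laplacian_prod_cosh:
  fixes y :: "'a::euclidean_space"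
  shows "disc_laplacian \<delta> (\<lambda>y::'a. \<Prod>e\<in>Basis. cosh (b * (y \<bullet> e))) y =
     2 * real DIM('a) * (cosh (\<delta> * b) - 1) / \<delta>\<^sup>2 * (\<Prod>e\<in>Basis. cosh (b * (y \<bullet> e)))"
proof -
  define P where "P = (\<lambda>y::'a. \<Prod>e\<in>Basis. cosh (b * (y \<bullet> e)))"
  have step: "P (y + \<delta> *\<^sub>R e) + P (y - \<delta> *\<^sub>R e) = 2 * cosh (\<delta> * b) * P y"
    if e: "e \<in> Basis" for e
  proof -
    define Q where "Q = (\<Prod>i\<in>Basis - {e}. cosh (b * (y \<bullet> i)))"
    have P: "P (y + t *\<^sub>R e) = cosh (b * (y \<bullet> e) + b * t) * Q" for t
    proof -
      have "P (y + t *\<^sub>R e) = cosh (b * ((y + t *\<^sub>R e) \<bullet> e)) *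
          (\<Prod>i\<in>Basis - {e}. cosh (b * ((y + t *\<^sub>R e) \<bullet> i)))"
        unfolding P_def by (rule prod.remove) (use e in auto)
      also have "(\<Prod>i\<in>Basis - {e}. cosh (b * ((y + t *\<^sub>R e) \<bullet> i))) = Q"
        unfolding Q_def
        by (rule prod.cong) (use e in \<open>auto simp: inner_add_left inner_not_same_Basis\<close>)
      finally show ?thesis using e by (simp add: inner_add_left algebra_simps)
    qed
    show ?thesis
      using P[of \<delta>] P[of "- \<delta>"] P[of 0]
      by (simp add: cosh_add cosh_diff algebra_simps)
  qed
  have "disc_laplacian \<delta> P y =
      ((\<Sum>e\<in>(Basis::'a set). 2 * cosh (\<delta> * b) * P y) - 2 * real DIM('a) * P y) / \<delta>\<^sup>2"
    unfolding disc_laplacian_def using step by (simp cong: sum.cong)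
  also have "\<dots> = 2 * real DIM('a) * (cosh (\<delta> * b) - 1) / \<delta>\<^sup>2 * P y"
    by (simp add: algebra_simps diff_divide_distrib add_divide_distrib)
  finally show ?thesis unfolding P_def .
qed

lemma norm1_Basis: "norm1 (y :: real ^ 'k) = (\<Sum>e\<in>Basis. \<bar>y \<bullet> e\<bar>)"
proof -
  have *: "(Basis :: (real ^ 'k) set) = range (\<lambda>j. axis j 1)"
    by (auto simp: Basis_vec_def)
  have "inj (\<lambda>j. axis j (1::real) :: real ^ 'k)"
    by (auto simp: inj_on_def axis_eq_axis)
  thus ?thesis
    unfolding * norm1_def by (simp add: sum.reindex inner_axis)
qed

lemma exp_norm1_le_prod_cosh:
  fixes y :: "real ^ 'k"
  shows "exp (b * norm1 y) \<le> 2 ^ CARD('k) * (\<Prod>e\<in>Basis. cosh (b * (y \<bullet> e)))"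
proof -
  have "exp (b * norm1 y) = (\<Prod>e\<in>(Basis :: (real ^ 'k) set). exp (b * \<bar>y \<bullet> e\<bar>))"
    by (simp add: norm1_Basis sum_distrib_left exp_sum)
  also have "\<dots> \<le> (\<Prod>e\<in>(Basis :: (real ^ 'k) set). 2 * cosh (b * (y \<bullet> e)))"
  proof (intro prod_mono conjI)
    fix e :: "real ^ 'k"
    show "exp (b * \<bar>y \<bullet> e\<bar>) \<le> 2 * cosh (b * (y \<bullet> e))"
      by (cases "y \<bullet> e \<ge> 0") (auto simp: cosh_field_def)
  qed auto
  also have "\<dots> = 2 ^ CARD('k) * (\<Prod>e\<in>Basis. cosh (b * (y \<bullet> e)))"
    by (simp add: prod.distrib)
  finally show ?thesis .
qed

lemma sum_Basis_prod:
  fixes F :: "'a::euclidean_space \<times> 'b::euclidean_space \<Rightarrow> real"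
  shows "(\<Sum>e\<in>Basis. F e) = (\<Sum>e\<in>Basis. F (e, 0)) + (\<Sum>e\<in>Basis. F (0, e))"
proof -
  have "(\<Sum>e\<in>Basis. F e) = sum F ((\<lambda>u. (u, 0)) ` Basis) + sum F ((\<lambda>v. (0, v)) ` Basis)"
    unfolding Basis_prod_def by (rule sum.union_disjoint) auto
  thus ?thesis by (simp add: sum.reindex inj_on_def)
qed

lemma disc_laplacian_separated:
  fixes f :: "'a::euclidean_space \<Rightarrow> real" and g :: "'b::euclidean_space \<Rightarrow> real"
  shows "disc_laplacian \<delta> (\<lambda>(x, y). f x * g y) (x, y) =
     disc_laplacian \<delta> f x * g y + f x * disc_laplacian \<delta> g y"
  unfolding disc_laplacian_def sum_Basis_prod
  by (simp add: sum_distrib_left sum_distrib_right algebra_simps sum.distrib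
      add_divide_distrib diff_divide_distrib)

lemma disc_laplacian_lincomb:
  "disc_laplacian \<delta> (\<lambda>z. s * u z + t * v z) z = s * disc_laplacian \<delta> u z + t * disc_laplacian \<delta> v z"
  unfolding disc_laplacian_def
  by (simp add: sum_distrib_left sum.distrib algebra_simps
      add_divide_distrib diff_divide_distrib)

lemma disc_laplacian_cmult: "disc_laplacian \<delta> (\<lambda>z. t * u z) z = t * disc_laplacian \<delta> u z"
  using disc_laplacian_lincomb[of \<delta> t u 0 u z] by simp

section \<open>Comparison and uniqueness\<close>

lemma disc_maximum_principle:
  fixes g :: "'a::euclidean_space \<Rightarrow> real"
  assumes fin: "finite D" and \<delta>: "0 < \<delta>"
    and sub: "\<And>z. z \<in> D \<Longrightarrow> 0 \<le> disc_laplacian \<delta> g z"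
    and out: "\<And>z z'. z \<in> D \<Longrightarrow> neighbors \<delta> z z' \<Longrightarrow> z' \<notin> D \<Longrightarrow> g z' \<le> 0"
    and z0: "z0 \<in> D"
  shows "g z0 \<le> 0"
proof (rule ccontr)
  assume "\<not> g z0 \<le> 0"
  define m where "m = Max (g ` D)"
  have le: "g z \<le> m" if "z \<in> D" for z using fin that by (simp add: m_def)
  have m: "m > 0" using le[OF z0] \<open>\<not> g z0 \<le> 0\<close> by simp
  have "m \<in> g ` D" unfolding m_def using fin z0 by (intro Max_in) auto
  define D' where "D' = {z \<in> D. g z = m}"
  have D': "finite D'" "D' \<noteq> {}" using fin \<open>m \<in> g ` D\<close> by (auto simp: D'_def)
  \<comment> \<open>Among the maximum points take one that is extremal in the direction \<open>e0\<close>: the next point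
    in this direction is a maximum point as well.\<close>
  obtain e0 :: 'a where e0: "e0 \<in> Basis" using nonempty_Basis by blast
  obtain z where z: "z \<in> D'" and zmax: "\<And>z'. z' \<in> D' \<Longrightarrow> z' \<bullet> e0 \<le> z \<bullet> e0"
    using obtains_MAX[OF D', of "\<lambda>z. z \<bullet> e0"] D'(1) by (metis Max_ge finite_imageI imageI)
  have zD: "z \<in> D" "g z = m" using z by (auto simp: D'_def)
  have nb: "g z' \<le> m" if "neighbors \<delta> z z'" for z'
    using le out[OF zD(1) that] m by (cases "z' \<in> D") auto
  have n1: "neighbors \<delta> z (z + \<delta> *\<^sub>R e)" "neighbors \<delta> z (z - \<delta> *\<^sub>R e)" if "e \<in> Basis" for e
    using that by (auto simp: neighbors_def)
  have "(\<Sum>e\<in>Basis. (m - g (z + \<delta> *\<^sub>R e)) + (m - g (z - \<delta> *\<^sub>R e))) \<le> 0"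
    using sub[OF zD(1)] \<delta>
    by (simp add: disc_laplacian_def zD sum.distrib sum_subtractf field_simps)
  moreover have nn: "0 \<le> (m - g (z + \<delta> *\<^sub>R e)) + (m - g (z - \<delta> *\<^sub>R e))" if "e \<in> Basis" for e
    using nb[OF n1(1)[OF that]] nb[OF n1(2)[OF that]] by simp
  ultimately have "(\<Sum>e\<in>Basis. (m - g (z + \<delta> *\<^sub>R e)) + (m - g (z - \<delta> *\<^sub>R e))) = 0"
    by (intro antisym sum_nonneg) auto
  hence "(m - g (z + \<delta> *\<^sub>R e0)) + (m - g (z - \<delta> *\<^sub>R e0)) = 0"
    using sum_nonneg_eq_0_iff[OF finite_Basis nn] e0 by fastforce
  hence eq: "g (z + \<delta> *\<^sub>R e0) = m"
    using nb[OF n1(1)[OF e0]] nb[OF n1(2)[OF e0]] by simp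
  hence "z + \<delta> *\<^sub>R e0 \<in> D'"
    using out[OF zD(1) n1(1)[OF e0]] m by (force simp: D'_def)
  from zmax[OF this] show False using e0 \<delta> by (simp add: inner_add_left)
qed

text \<open>
  The hypothesis for large \<open>y\<close> reduces the inequality to finitely many lattice points; a
  neighbour of one of these is either among them, or on the lateral boundary, or has large \<open>y\<close>.
\<close>

lemma cylinder_comparison_principle:
  fixes w h :: "(real ^ 'n) \<times> (real ^ 'k) \<Rightarrow> real"
  assumes fin: "finite (disc_interior \<delta> \<Omega>)" and \<delta>: "0 < \<delta>"
    and lap: "\<And>z. z \<in> disc_interior \<delta> \<Omega> \<times> lattice \<delta> \<Longrightarrow> disc_laplacian \<delta> h z \<le> disc_laplacian \<delta> w z"
    and bd: "\<And>x y. x \<in> disc_boundary \<delta> \<Omega> \<Longrightarrow> y \<in> lattice \<delta> \<Longrightarrow> w (x, y) \<le> h (x, y)"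
    and far: "\<And>x y. x \<in> disc_interior \<delta> \<Omega> \<Longrightarrow> y \<in> lattice \<delta> \<Longrightarrow> R \<le> norm1 y \<Longrightarrow> w (x, y) \<le> h (x, y)"
    and x: "x \<in> disc_interior \<delta> \<Omega>" and y: "y \<in> lattice \<delta>"
  shows "w (x, y) \<le> h (x, y)"
proof (cases "R \<le> norm1 y")
  case True
  thus ?thesis using far x y by blast
next
  case False
  let ?S = "disc_interior \<delta> \<Omega>" and ?Y = "disc_interior \<delta> {y :: real ^ 'k. norm1 y < R}"
  define g where "g = (\<lambda>z. 1 * w z + (-1) * h z)"
  have "bounded {y :: real ^ 'k. norm1 y < R}"
    unfolding bounded_iff norm1_def using norm_le_l1_cart less_imp_le order_trans by blast
  hence finD: "finite (?S \<times> ?Y)"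
    using fin finite_disc_interior \<delta> by blast
  have cl: "g (x', y') \<le> 0"
    if "x' \<in> disc_closure \<delta> \<Omega>" "y' \<in> lattice \<delta>" "(x', y') \<notin> ?S \<times> ?Y" for x' y'
    using that far[of x' y'] bd[of x' y']
    by (auto simp: g_def disc_closure_def disc_interior_def[of \<delta> "{y. norm1 y < R}"])
  have "g (x, y) \<le> 0"
  proof (rule disc_maximum_principle[OF finD \<delta>])
    fix z assume "z \<in> ?S \<times> ?Y"
    hence "z \<in> ?S \<times> lattice \<delta>" by (auto simp: disc_interior_def)
    from lap[OF this] show "0 \<le> disc_laplacian \<delta> g z"
      unfolding g_def disc_laplacian_lincomb by simp
  next
    fix z z' assume z: "z \<in> ?S \<times> ?Y" and nb: "neighbors \<delta> z z'" and z': "z' \<notin> ?S \<times> ?Y"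
    obtain x1 y1 where [simp]: "z = (x1, y1)" by (cases z)
    have x1: "x1 \<in> ?S" and y1: "y1 \<in> lattice \<delta>" using z by (auto simp: disc_interior_def)
    have x1': "x1 \<in> disc_closure \<delta> \<Omega>" using x1 by (simp add: disc_closure_def)
    obtain e where e: "e \<in> Basis" "z' = z + \<delta> *\<^sub>R e \<or> z' = z - \<delta> *\<^sub>R e"
      using nb by (auto simp: neighbors_def)
    have "fst z' \<in> disc_closure \<delta> \<Omega> \<and> snd z' \<in> lattice \<delta>"
      using e x1' y1 disc_closure_step[OF x1] lattice_step[OF y1]
      by (auto simp: Basis_prod_def)
    thus "g z' \<le> 0" using cl[of "fst z'" "snd z'"] z' by simp
  next
    show "(x, y) \<in> ?S \<times> ?Y" using x y False by (auto simp: disc_interior_def)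
  qed
  thus ?thesis by (simp add: g_def)
qed

theorem mainTheorem2:
  fixes \<Omega> :: "(real ^ 'n) set"
    and \<delta> \<delta>0 b :: real
    and u v :: "(real ^ 'n) \<times> (real ^ 'k) \<Rightarrow> real"
  assumes "bounded_lipschitz_domain \<Omega>"
    and "mesh_bound \<Omega> \<delta>0"
    and "0 < \<delta>" and "\<delta> < \<delta>0"
    and "0 < b"
    and "cosh (\<delta> * b) = 1 + 1 / (2 * real CARD('k)) * \<delta>\<^sup>2 * first_eigenvalue \<delta> \<Omega>"
    and "disc_harmonic_on \<delta> (disc_interior \<delta> \<Omega> \<times> lattice \<delta>) u"
    and "disc_harmonic_on \<delta> (disc_interior \<delta> \<Omega> \<times> lattice \<delta>) v"
    and "little_o_exp \<delta> \<Omega> b u"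
    and "little_o_exp \<delta> \<Omega> b v"
    and "\<forall>x\<in>disc_boundary \<delta> \<Omega>. \<forall>y\<in>lattice \<delta>. u (x, y) = v (x, y)"
  shows "\<forall>x\<in>disc_interior \<delta> \<Omega>. \<forall>y\<in>lattice \<delta>. u (x, y) = v (x, y)"
proof -
  let ?S = "disc_interior \<delta> \<Omega>"
  note \<delta> = \<open>0 < \<delta>\<close>
  have fin: "finite ?S"
    using finite_disc_interior \<delta> assms(1) by (auto simp: bounded_lipschitz_domain_def)
  have ne: "?S \<noteq> {}" and conn: "disc_connected \<delta> ?S"
    using assms(2-4) by (auto simp: mesh_bound_def)
  obtain f where fpos: "\<And>x. x \<in> ?S \<Longrightarrow> 0 < f x"
    and fbd: "\<And>x. x \<in> disc_boundary \<delta> \<Omega> \<Longrightarrow> f x = 0"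
    and flap: "\<And>x. x \<in> ?S \<Longrightarrow> disc_laplacian \<delta> f x = - (first_eigenvalue \<delta> \<Omega> * f x)"
    using first_eigenfunction[OF fin ne conn \<delta>] by blast
  define P where "P = (\<lambda>y::real ^ 'k. \<Prod>e\<in>Basis. cosh (b * (y \<bullet> e)))"
  define h where "h = (\<lambda>(x, y). f x * P y)"
  have hlap: "disc_laplacian \<delta> h z = 0" if "z \<in> ?S \<times> lattice \<delta>" for z
  proof -
    from that obtain x y where z: "z = (x, y)" "x \<in> ?S" by auto
    have "disc_laplacian \<delta> P y = first_eigenvalue \<delta> \<Omega> * P y"
      unfolding P_def disc_laplacian_prod_cosh assms(6) using \<delta> by simp
    thus ?thesis
      unfolding h_def z(1) disc_laplacian_separated using flap[OF z(2)] by simp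
  qed
  have Ppos: "P y > 0" for y by (auto simp: P_def intro!: prod_pos)
  define c where "c = Min (f ` ?S)"
  have c: "c > 0" and cle: "\<And>x. x \<in> ?S \<Longrightarrow> c \<le> f x"
    using fin ne fpos by (auto simp: c_def)
  have key: "\<bar>u (x, y) - v (x, y)\<bar> \<le> \<epsilon> * h (x, y)"
    if x: "x \<in> ?S" and y: "y \<in> lattice \<delta>" and \<epsilon>: "\<epsilon> > 0" for x y \<epsilon>
  proof -
    \<comment> \<open>The factor 2 accounts for the two functions, the power of 2 for \<open>exp_norm1_le_prod_cosh\<close>.\<close>
    define \<eta> where "\<eta> = \<epsilon> * c / (2 * 2 ^ CARD('k))"
    have "\<eta> > 0" using \<epsilon> c by (simp add: \<eta>_def)
    then obtain R1 R2 where R1: "\<forall>x\<in>disc_closure \<delta> \<Omega>. \<forall>y\<in>lattice \<delta>.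
        norm1 y \<ge> R1 \<longrightarrow> \<bar>u (x, y)\<bar> \<le> \<eta> * exp (b * norm1 y)"
      and R2: "\<forall>x\<in>disc_closure \<delta> \<Omega>. \<forall>y\<in>lattice \<delta>.
        norm1 y \<ge> R2 \<longrightarrow> \<bar>v (x, y)\<bar> \<le> \<eta> * exp (b * norm1 y)"
      using assms(9,10) unfolding little_o_exp_def by meson
    have far: "\<bar>u (x, y) - v (x, y)\<bar> \<le> \<epsilon> * h (x, y)"
      if "x \<in> ?S" "y \<in> lattice \<delta>" "max R1 R2 \<le> norm1 y" for x y
    proof -
      have "x \<in> disc_closure \<delta> \<Omega>" using that by (simp add: disc_closure_def)
      hence "\<bar>u (x, y)\<bar> \<le> \<eta> * exp (b * norm1 y)" "\<bar>v (x, y)\<bar> \<le> \<eta> * exp (b * norm1 y)"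
        using R1 R2 that by auto
      hence "\<bar>u (x, y) - v (x, y)\<bar> \<le> 2 * \<eta> * exp (b * norm1 y)" by linarith
      also have "\<dots> \<le> 2 * \<eta> * (2 ^ CARD('k) * P y)"
        unfolding P_def using \<open>\<eta> > 0\<close> by (intro mult_left_mono exp_norm1_le_prod_cosh) auto
      also have "\<dots> = \<epsilon> * (c * P y)" by (simp add: \<eta>_def)
      also have "\<dots> \<le> \<epsilon> * h (x, y)"
        unfolding h_def using \<epsilon> cle[OF that(1)] less_imp_le[OF Ppos[of y]]
        by (auto intro!: mult_left_mono mult_right_mono)
      finally show ?thesis .
    qed
    have "s * u (x, y) + t * v (x, y) \<le> \<epsilon> * h (x, y)"
      if "(s, t) = (1, -1) \<or> (s, t) = (-1, 1)" for s t
    proof (rule cylinder_comparison_principle[OF fin \<delta>, where R = "max R1 R2"])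
      fix z assume "z \<in> ?S \<times> (lattice \<delta> :: (real ^ 'k) set)"
      hence "disc_laplacian \<delta> u z = 0" "disc_laplacian \<delta> v z = 0" "disc_laplacian \<delta> h z = 0"
        using assms(7,8) hlap unfolding disc_harmonic_on_def by blast+
      thus "disc_laplacian \<delta> (\<lambda>z. \<epsilon> * h z) z
            \<le> disc_laplacian \<delta> (\<lambda>z. s * u z + t * v z) z"
        unfolding disc_laplacian_lincomb disc_laplacian_cmult by simp
    next
      fix x y assume "x \<in> disc_boundary \<delta> \<Omega>" "y \<in> (lattice \<delta> :: (real ^ 'k) set)"
      thus "s * u (x, y) + t * v (x, y) \<le> \<epsilon> * h (x, y)"
        using assms(11) fbd that by (auto simp: h_def)
    next
      fix x y assume "x \<in> ?S" "y \<in> (lattice \<delta> :: (real ^ 'k) set)" "max R1 R2 \<le> norm1 y"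
      from far[OF this] show "s * u (x, y) + t * v (x, y) \<le> \<epsilon> * h (x, y)"
        using that by auto
    qed (rule x, rule y)
    from this[of 1 "-1"] this[of "-1" 1] show ?thesis by (simp add: abs_le_iff)
  qed
  show ?thesis
  proof (intro ballI)
    fix x y assume x: "x \<in> ?S" and y: "y \<in> (lattice \<delta> :: (real ^ 'k) set)"
    have h: "h (x, y) > 0" using fpos[OF x] Ppos by (simp add: h_def)
    have "\<bar>u (x, y) - v (x, y)\<bar> \<le> 0"
    proof (rule field_le_epsilon)
      fix \<epsilon> :: real assume "\<epsilon> > 0"
      with key[OF x y, of "\<epsilon> / h (x, y)"] h
      show "\<bar>u (x, y) - v (x, y)\<bar> \<le> 0 + \<epsilon>" by simp
    qed
    thus "u (x, y) = v (x, y)" by simp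
  qed
qed

end
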